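(* For each of the following quadratic systems, with parameter in the stated range, the limit cycle $\gamma$ given by the (real) oval of the indicated invariant algebraic curve is hyperbolic, i.e. $\int_0^T\left(\frac{\partial P}{\partial x}+\frac{\partial Q}{\partial y}\right)(\gamma(t))\,dt\neq 0$, where $T>0$ is the period of $\gamma$ and $(P,Q)$ is the vector field: (i) $\dot x=6(1+a)x+2y-6(2+a)x^2+12xy$, $\dot y=15(1+a)y+3a(1+a)x^2-2(9+5a)xy+16y^2$, with $0<a<\frac{3}{13}$, and curve $3(1+a)(ax^2+y)^2+2y^2(2y-3(1+a)x)=0$; (ii) $\dot x=5x+6x^2+4(1+a)xy+ay^2$, $\dot y=x+2y+4xy+(2+3a)y^2$, with $\frac{-71+17\sqrt{17}}{32}<a<0$, and curve $x^2+x^3+x^2y+2axy^2+2axy^3+a^2y^4=0$; (iii) $\dot x=2(1+2x-2ax^2+6xy)$, $\dot y=8-3a-14ax-2axy-8y^2$, with $0<a<\frac14$, and curve $\frac14+x-x^2+ax^3+xy+x^2y^2=0$.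
   Context: In each case the indicated curve is invariant under the system and its oval is a limit cycle of the system (a known fact for these parameter ranges). A limit cycle $\gamma$ of period $T$ is called hyperbolic when the integral of the divergence $\partial P/\partial x+\partial Q/\partial y$ along $\gamma$ over one period is nonzero. *)

theory Defs
  imports "HOL-Analysis.Analysis"
begin

definition divergence :: "(real \<Rightarrow> real \<Rightarrow> real) \<Rightarrow> (real \<Rightarrow> real \<Rightarrow> real) \<Rightarrow> real \<Rightarrow> real \<Rightarrow> real" where
  "divergence P Q u v = deriv (\<lambda>s. P s v) u + deriv (\<lambda>s. Q u s) v"

definition periodic_orbit_on ::
  "(real \<Rightarrow> real \<Rightarrow> real) \<Rightarrow> (real \<Rightarrow> real \<Rightarrow> real) \<Rightarrow> (real \<Rightarrow> real \<Rightarrow> real)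
   \<Rightarrow> (real \<Rightarrow> real) \<Rightarrow> (real \<Rightarrow> real) \<Rightarrow> real \<Rightarrow> bool" where
  "periodic_orbit_on P Q F x y T \<longleftrightarrow>
     T > 0 \<and>
     (\<forall>t. (x has_real_derivative P (x t) (y t)) (at t) \<and>
          (y has_real_derivative Q (x t) (y t)) (at t)) \<and>
     (\<forall>t. x (t + T) = x t \<and> y (t + T) = y t) \<and>
     (\<forall>t. F (x t) (y t) = 0) \<and>
     \<not> (\<forall>t. x t = x 0 \<and> y t = y 0)"

definition hyperbolic_cycle ::
  "(real \<Rightarrow> real \<Rightarrow> real) \<Rightarrow> (real \<Rightarrow> real \<Rightarrow> real) \<Rightarrow> (real \<Rightarrow> real) \<Rightarrow> (real \<Rightarrow> real) \<Rightarrow> real \<Rightarrow> bool" where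
  "hyperbolic_cycle P Q x y T \<longleftrightarrow> integral {0..T} (\<lambda>t. divergence P Q (x t) (y t)) \<noteq> 0"

definition P1 :: "real \<Rightarrow> real \<Rightarrow> real \<Rightarrow> real" where
  "P1 a x y = 6*(1+a)*x + 2*y - 6*(2+a)*x^2 + 12*x*y"
definition Q1 :: "real \<Rightarrow> real \<Rightarrow> real \<Rightarrow> real" where
  "Q1 a x y = 15*(1+a)*y + 3*a*(1+a)*x^2 - 2*(9+5*a)*x*y + 16*y^2"
definition F1 :: "real \<Rightarrow> real \<Rightarrow> real \<Rightarrow> real" where
  "F1 a x y = 3*(1+a)*(a*x^2 + y)^2 + 2*y^2*(2*y - 3*(1+a)*x)"

definition P2 :: "real \<Rightarrow> real \<Rightarrow> real \<Rightarrow> real" where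
  "P2 a x y = 5*x + 6*x^2 + 4*(1+a)*x*y + a*y^2"
definition Q2 :: "real \<Rightarrow> real \<Rightarrow> real \<Rightarrow> real" where
  "Q2 a x y = x + 2*y + 4*x*y + (2+3*a)*y^2"
definition F2 :: "real \<Rightarrow> real \<Rightarrow> real \<Rightarrow> real" where
  "F2 a x y = x^2 + x^3 + x^2*y + 2*a*x*y^2 + 2*a*x*y^3 + a^2*y^4"

definition P3 :: "real \<Rightarrow> real \<Rightarrow> real \<Rightarrow> real" where
  "P3 a x y = 2*(1 + 2*x - 2*a*x^2 + 6*x*y)"
definition Q3 :: "real \<Rightarrow> real \<Rightarrow> real \<Rightarrow> real" where
  "Q3 a x y = 8 - 3*a - 14*a*x - 2*a*x*y - 8*y^2"
definition F3 :: "real \<Rightarrow> real \<Rightarrow> real \<Rightarrow> real" where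
  "F3 a x y = 1/4 + x - x^2 + a*x^3 + x*y + x^2*y^2"

end

theory Submission
  imports Defs
begin

text \<open>
  On each oval a suitable pair \<open>(s, v)\<close> satisfies an equation \<open>v\<^sup>2 = c(s)\<close>, so that the oval is symmetric
  under \<open>v \<mapsto> - v\<close>, and \<open>s' = v \<sqdot> h\<close> with \<open>h\<close> of constant sign.  The divergence is then written as a combination
  of derivatives along the orbit (logarithmic derivatives, \<open>B(s) s'\<close>, and one rational function),
  all of which integrate to zero over a period, plus a remainder of constant sign that does not vanish identically.
  A periodic orbit on another branch of the curve is impossible: a function that is monotone
  along that branch has a critical point on the orbit by Rolle's theorem, and such a point turns out to be an equilibrium.
\<close>

section \<open>Integrals over a period and closed orbits\<close>

text \<open>The difficulty is that \<open>h\<close> itself depends on \<open>v\<close>, so a term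
  odd in \<open>v\<close> is not yet of the form \<open>B(s) s'\<close>. In the first two systems
  the conjugate of \<open>h\<close> under \<open>v \<mapsto> - v\<close> helps: by the curve
  equation, \<open>h\<close> times its conjugate is a positive function of \<open>s\<close> alone.
  Logarithmic derivatives first reduce the divergence to a leftover linear in \<open>v\<close>.
  Multiplying that leftover by \<open>h\<close> times its conjugate over their product, which is 1,
  and replacing \<open>v\<^sup>2\<close> by \<open>c(s)\<close> leaves \<open>h\<close> times an
  expression linear in \<open>v\<close>: its odd part is \<open>B(s) s'\<close>, its even part is
  \<open>h\<close> times a function of \<open>s\<close>, and only that function needs a sign. In the
  third system logarithmic derivatives alone leave a positive multiple of
  \<open>(v / x)\<^sup>2\<close>.

  \<open>periodic_orbit_on\<close> asks only for a nonconstant closed orbit inside the zero set of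
  the curve. Its position on the oval and the sign of \<open>h\<close> must therefore be derived,
  from the curve equation and from the fact that a nonconstant orbit never meets an
  equilibrium.\<close>

lemma has_real_derivative_imp_continuous_on:
  fixes g g' :: "real \<Rightarrow> real"
  assumes "\<And>t. (g has_real_derivative g' t) (at t)"
  shows "continuous_on S g"
  using assms by (intro continuous_at_imp_continuous_on ballI) (rule DERIV_isCont)

text \<open>The change of variables turns the integral into one of \<open>f\<close> between the
  equal endpoints \<open>g 0\<close> and \<open>g T\<close>. The interval \<open>S\<close> leaves
  room for an \<open>f\<close> with poles elsewhere, such as \<open>inverse\<close> or a rational
  function.\<close>

lemma closed_substitution_has_integral_0:
  fixes g g' f :: "real \<Rightarrow> real"
  assumes "0 \<le> T" and g: "\<And>t. (g has_real_derivative g' t) (at t)" and "g T = g 0"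
    and "is_interval S" and S: "\<And>t. g t \<in> S" and f: "continuous_on S f"
  shows "((\<lambda>t. f (g t) * g' t) has_integral 0) {0..T}"
proof -
  have cont: "continuous_on {0..T} g"
    using g by (rule has_real_derivative_imp_continuous_on)
  \<comment> \<open>The substitution rule wants a compact interval that contains all values of
    \<open>g\<close> and on which \<open>f\<close> is continuous: the one between the minimum and
    the maximum of \<open>g\<close>.\<close>
  obtain l where l: "l \<in> {0..T}" "\<And>t. t \<in> {0..T} \<Longrightarrow> g l \<le> g t"
    using continuous_attains_inf[OF _ _ cont] \<open>0 \<le> T\<close> by force
  obtain h where h: "h \<in> {0..T}" "\<And>t. t \<in> {0..T} \<Longrightarrow> g t \<le> g h"
    using continuous_attains_sup[OF _ _ cont] \<open>0 \<le> T\<close> by force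
  have "{g l..g h} \<subseteq> S"
    using \<open>is_interval S\<close> S[of l] S[of h] unfolding is_interval_1 by (meson atLeastAtMost_iff subsetI)
  then have "continuous_on {g l..g h} f"
    using f continuous_on_subset by blast
  then have "((\<lambda>t. g' t *\<^sub>R f (g t)) has_integral integral {g 0..g T} f) {0..T}"
    using l h g \<open>0 \<le> T\<close> \<open>g T = g 0\<close>
    by (intro has_integral_substitution[where c = "g l" and d = "g h"])
       (auto intro: DERIV_subset)
  then show ?thesis
    using \<open>g T = g 0\<close> by (simp add: mult.commute)
qed

lemma has_integral_0_linear:
  fixes f g :: "real \<Rightarrow> real"
  shows "(f has_integral 0) S \<Longrightarrow> (g has_integral 0) S \<Longrightarrow> ((\<lambda>t. f t + g t) has_integral 0) S"
    and "(f has_integral 0) S \<Longrightarrow> (g has_integral 0) S \<Longrightarrow> ((\<lambda>t. f t - g t) has_integral 0) S"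
    and "(f has_integral 0) S \<Longrightarrow> ((\<lambda>t. c * f t) has_integral 0) S"
  using has_integral_add[of f 0 S g 0] has_integral_diff[of f 0 S g 0] has_integral_mult_right[of f 0 S c]
  by simp_all

text \<open>A continuous nonnegative function with zero integral vanishes on the whole interval, so
  one point \<open>t0\<close> decides. The factor \<open>c\<close> carries the sign of the
  remainder, which is not the same in all systems.\<close>

lemma integral_nonzero_modulo_closed:
  fixes e k :: "real \<Rightarrow> real"
  assumes "0 < T" and e: "(e has_integral 0) {0..T}"
    and k: "continuous_on {0..T} k" "\<And>t. t \<in> {0..T} \<Longrightarrow> 0 \<le> k t"
    and "t0 \<in> {0..T}" "k t0 \<noteq> 0"
    and f: "\<And>t. f t = e t + c * k t" and "c \<noteq> 0"
  shows "integral {0..T} f \<noteq> 0"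
proof -
  have "(k has_integral integral {0..T} k) {0..T}"
    using k(1) by (simp add: integrable_continuous_real integrable_integral)
  from has_integral_add[OF e has_integral_mult_right[OF this, of c]]
  have "integral {0..T} f = c * integral {0..T} k"
    unfolding f[abs_def] by (simp add: integral_unique)
  moreover have "integral {0..T} k \<noteq> 0"
    using integral_eq_0_iff[OF k(1) \<open>0 < T\<close>] k(2) assms(5,6) by auto
  ultimately show ?thesis using \<open>c \<noteq> 0\<close> by simp
qed

text \<open>Gronwall's argument for \<open>h\<^sup>2 + k\<^sup>2\<close>: its derivative is bounded
  by a constant times itself, so a decaying exponential factor settles times after \<open>t0\<close>
  and a growing one times before.\<close>

lemma linear_system_zero:
  fixes h k A B C D :: "real \<Rightarrow> real"
  assumes h: "\<And>t. (h has_real_derivative A t * h t + B t * k t) (at t)"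
    and k: "\<And>t. (k has_real_derivative C t * h t + D t * k t) (at t)"
    and cont: "continuous_on UNIV A" "continuous_on UNIV B" "continuous_on UNIV C" "continuous_on UNIV D"
    and zero: "h t0 = 0" "k t0 = 0"
  shows "h t = 0 \<and> k t = 0"
proof -
  define I where "I = {min t0 t..max t0 t}"
  define M where "M = (\<lambda>t. 2 * \<bar>A t\<bar> + \<bar>B t\<bar> + \<bar>C t\<bar> + 2 * \<bar>D t\<bar>)"
  have "continuous_on UNIV M"
    unfolding M_def by (intro continuous_intros cont)
  then have "continuous_on I M" using continuous_on_subset by blast
  moreover have "compact I" "I \<noteq> {}" unfolding I_def by auto
  \<comment> \<open>\<open>K\<close> is a time at which \<open>M\<close> is largest; the Gronwall
    constant is the value \<open>M K\<close>.\<close>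
  ultimately obtain K where "K \<in> I" and K: "\<And>u. u \<in> I \<Longrightarrow> M u \<le> M K"
    using continuous_attains_sup by metis
  define \<phi> where "\<phi> = (\<lambda>t. (h t)\<^sup>2 + (k t)\<^sup>2)"
  define \<phi>' where "\<phi>' = (\<lambda>t. 2 * h t * (A t * h t + B t * k t) + 2 * k t * (C t * h t + D t * k t))"
  have d: "(\<phi> has_real_derivative \<phi>' t) (at t)" for t
    unfolding \<phi>_def \<phi>'_def by (auto intro!: derivative_eq_intros h k)
  have bound: "\<bar>\<phi>' u\<bar> \<le> M K * \<phi> u" if "u \<in> I" for u
  proof -
    have hk: "\<bar>2 * h u * k u\<bar> \<le> \<phi> u"
      using sum_squares_bound[of "\<bar>h u\<bar>" "\<bar>k u\<bar>"] by (simp add: \<phi>_def abs_mult)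
    have "\<phi>' u = 2 * A u * (h u)\<^sup>2 + (B u + C u) * (2 * h u * k u) + 2 * D u * (k u)\<^sup>2"
      unfolding \<phi>'_def by (simp add: algebra_simps power2_eq_square)
    also have "\<bar>\<dots>\<bar> \<le> \<bar>2 * A u * (h u)\<^sup>2\<bar> + \<bar>(B u + C u) * (2 * h u * k u)\<bar> + \<bar>2 * D u * (k u)\<^sup>2\<bar>"
      by linarith
    also have "\<dots> \<le> 2 * \<bar>A u\<bar> * \<phi> u + (\<bar>B u\<bar> + \<bar>C u\<bar>) * \<phi> u + 2 * \<bar>D u\<bar> * \<phi> u"
    proof (intro add_mono)
      show "\<bar>2 * A u * (h u)\<^sup>2\<bar> \<le> 2 * \<bar>A u\<bar> * \<phi> u" "\<bar>2 * D u * (k u)\<^sup>2\<bar> \<le> 2 * \<bar>D u\<bar> * \<phi> u"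
        unfolding abs_mult by (auto intro!: mult_mono simp: \<phi>_def)
      show "\<bar>(B u + C u) * (2 * h u * k u)\<bar> \<le> (\<bar>B u\<bar> + \<bar>C u\<bar>) * \<phi> u"
        unfolding abs_mult[of "B u + C u"] by (intro mult_mono hk) auto
    qed
    also have "\<dots> = M u * \<phi> u" unfolding M_def by (simp add: algebra_simps)
    also have "\<dots> \<le> M K * \<phi> u"
      using K[OF that] by (intro mult_right_mono) (auto simp: \<phi>_def)
    finally show ?thesis .
  qed
  have "\<phi> t \<le> 0"
  proof (cases "t0 \<le> t")
    case True
    have "\<phi> t * exp (- M K * t) \<le> \<phi> t0 * exp (- M K * t0)"
    proof (rule DERIV_nonpos_imp_nonincreasing[OF True])
      fix u assume u: "t0 \<le> u" "u \<le> t"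
      have "((\<lambda>u. \<phi> u * exp (- M K * u)) has_real_derivative (\<phi>' u - M K * \<phi> u) * exp (- M K * u)) (at u)"
        by (auto intro!: derivative_eq_intros d simp: algebra_simps)
      moreover have "(\<phi>' u - M K * \<phi> u) * exp (- M K * u) \<le> 0"
        using bound[of u] u by (intro mult_nonpos_nonneg) (auto simp: I_def)
      ultimately show "\<exists>y. ((\<lambda>u. \<phi> u * exp (- M K * u)) has_real_derivative y) (at u) \<and> y \<le> 0" by blast
    qed
    then show ?thesis by (simp add: \<phi>_def zero mult_le_0_iff not_le)
  next
    case False
    have "\<phi> t * exp (M K * t) \<le> \<phi> t0 * exp (M K * t0)"
    proof (rule DERIV_nonneg_imp_nondecreasing[of t t0 "\<lambda>u. \<phi> u * exp (M K * u)"])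
      show "t \<le> t0" using False by simp
      fix u assume u: "t \<le> u" "u \<le> t0"
      have "((\<lambda>u. \<phi> u * exp (M K * u)) has_real_derivative (\<phi>' u + M K * \<phi> u) * exp (M K * u)) (at u)"
        by (auto intro!: derivative_eq_intros d simp: algebra_simps)
      moreover have "0 \<le> (\<phi>' u + M K * \<phi> u) * exp (M K * u)"
        using bound[of u] u by (intro mult_nonneg_nonneg) (auto simp: I_def)
      ultimately show "\<exists>y. ((\<lambda>u. \<phi> u * exp (M K * u)) has_real_derivative y) (at u) \<and> 0 \<le> y" by blast
    qed
    then show ?thesis by (simp add: \<phi>_def zero mult_le_0_iff not_le)
  qed
  then show ?thesis
    unfolding \<phi>_def by (simp add: sum_power2_le_zero_iff)
qed

text \<open>If the orbit met an equilibrium, its displacement from that point would solve a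
  homogeneous linear system with continuous coefficients and vanish at one time, hence always, and
  the orbit would be constant.\<close>

lemma quadratic_orbit_not_equilibrium:
  fixes x y :: "real \<Rightarrow> real"
  assumes orb: "periodic_orbit_on P Q F x y T"
    and P: "\<And>u v. P u v = p0 + p1 * u + p2 * v + p3 * u\<^sup>2 + p4 * u * v + p5 * v\<^sup>2"
    and Q: "\<And>u v. Q u v = q0 + q1 * u + q2 * v + q3 * u\<^sup>2 + q4 * u * v + q5 * v\<^sup>2"
  shows "P (x t) (y t) \<noteq> 0 \<or> Q (x t) (y t) \<noteq> 0"
proof (rule ccontr)
  assume "\<not> ?thesis"
  then have eq: "P (x t) (y t) = 0" "Q (x t) (y t) = 0" by auto
  have dx: "(x has_real_derivative P (x u) (y u)) (at u)" and dy: "(y has_real_derivative Q (x u) (y u)) (at u)" for u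
    using orb unfolding periodic_orbit_on_def by auto
  have cont: "continuous_on UNIV x" "continuous_on UNIV y"
    by (rule has_real_derivative_imp_continuous_on, rule dx dy)+
  \<comment> \<open>A quadratic minus its value at \<open>(u0, v0)\<close> is a combination of
    \<open>u - u0\<close> and \<open>v - v0\<close>; the mixed term is split as
    \<open>v * (u - u0) + u0 * (v - v0)\<close>.\<close>
  have split: "c0 + c1 * u + c2 * v + c3 * u\<^sup>2 + c4 * u * v + c5 * v\<^sup>2 =
      (c1 + c3 * (u + u0) + c4 * v) * (u - u0) + (c2 + c5 * (v + v0) + c4 * u0) * (v - v0)
      + (c0 + c1 * u0 + c2 * v0 + c3 * u0\<^sup>2 + c4 * u0 * v0 + c5 * v0\<^sup>2)"
    for c0 c1 c2 c3 c4 c5 u v u0 v0 :: real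
    by (simp add: algebra_simps power2_eq_square)
  have Pu: "P (x u) (y u) = (p1 + p3 * (x u + x t) + p4 * y u) * (x u - x t)
      + (p2 + p5 * (y u + y t) + p4 * x t) * (y u - y t)" for u
    using eq(1) split[of p0 p1 "x u" p2 "y u" p3 p4 p5 "x t" "y t"] unfolding P by linarith
  have Qu: "Q (x u) (y u) = (q1 + q3 * (x u + x t) + q4 * y u) * (x u - x t)
      + (q2 + q5 * (y u + y t) + q4 * x t) * (y u - y t)" for u
    using eq(2) split[of q0 q1 "x u" q2 "y u" q3 q4 q5 "x t" "y t"] unfolding Q by linarith
  have "x u - x t = 0 \<and> y u - y t = 0" for u
  proof (rule linear_system_zero[where h = "\<lambda>u. x u - x t" and k = "\<lambda>u. y u - y t" and ?t0.0 = t and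
        A = "\<lambda>u. p1 + p3 * (x u + x t) + p4 * y u" and B = "\<lambda>u. p2 + p5 * (y u + y t) + p4 * x t" and
        C = "\<lambda>u. q1 + q3 * (x u + x t) + q4 * y u" and D = "\<lambda>u. q2 + q5 * (y u + y t) + q4 * x t"])
    show "((\<lambda>u. x u - x t) has_real_derivative
        (p1 + p3 * (x u + x t) + p4 * y u) * (x u - x t) + (p2 + p5 * (y u + y t) + p4 * x t) * (y u - y t)) (at u)" for u
      using dx[of u] unfolding Pu by (auto intro!: derivative_eq_intros)
    show "((\<lambda>u. y u - y t) has_real_derivative
        (q1 + q3 * (x u + x t) + q4 * y u) * (x u - x t) + (q2 + q5 * (y u + y t) + q4 * x t) * (y u - y t)) (at u)" for u
      using dy[of u] unfolding Qu by (auto intro!: derivative_eq_intros)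
  qed (auto intro!: continuous_intros cont)
  then have "x u = x 0 \<and> y u = y 0" for u
    by (metis eq_iff_diff_eq_0)
  then show False using orb unfolding periodic_orbit_on_def by blast
qed

lemma closed_derivative_zero:
  fixes g g' :: "real \<Rightarrow> real"
  assumes "0 < T" "\<And>t. (g has_real_derivative g' t) (at t)" "g T = g 0"
  obtains t where "g' t = 0"
proof -
  have "continuous_on {0..T} g"
    using assms(2) by (rule has_real_derivative_imp_continuous_on)
  then show ?thesis
    using Rolle_deriv[of 0 T g "\<lambda>t. (*) (g' t)"] assms that
    by (metis has_field_derivative_def mult.right_neutral)
qed

lemma periodic_orbit_onD:
  assumes "periodic_orbit_on P Q F x y T"
  shows "0 < T" "(x has_real_derivative P (x t) (y t)) (at t)" "(y has_real_derivative Q (x t) (y t)) (at t)"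
    "x T = x 0" "y T = y 0" "F (x t) (y t) = 0"
  using assms unfolding periodic_orbit_on_def by (auto dest: spec[of _ 0])

text \<open>Applied at the midpoint of the period to show that \<open>v\<close> does not vanish
  identically: \<open>v\<close> and its derivative both zero there would give an
  equilibrium.\<close>

lemma derivative_zero_of_zero_on_interval:
  fixes g g' :: "real \<Rightarrow> real"
  assumes "\<And>t. (g has_real_derivative g' t) (at t)" and "\<And>t. t \<in> {0..T} \<Longrightarrow> g t = 0" and "t \<in> {0<..<T}"
  shows "g' t = 0"
proof -
  have "((\<lambda>_. 0) has_real_derivative g' t) (at t)"
    by (rule has_field_derivative_transform_within_open[OF assms(1) open_greaterThanLessThan assms(3)])
       (use assms(2) in auto)
  then show ?thesis using DERIV_unique DERIV_const by blast
qed

lemma closed_log_derivative_has_integral_0: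
  fixes g g' :: "real \<Rightarrow> real"
  assumes "0 < T" "\<And>t. (g has_real_derivative g' t) (at t)" "g T = g 0" "\<And>t. 0 < g t"
  shows "((\<lambda>t. g' t / g t) has_integral 0) {0..T}"
  using closed_substitution_has_integral_0[of T g g' "{0<..}" inverse] assms
  by (auto simp: is_interval_1 divide_inverse mult.commute continuous_on_inverse)

lemma nonvanishing_imp_constant_sign:
  fixes g :: "real \<Rightarrow> real"
  assumes "continuous_on UNIV g" "\<And>t. g t \<noteq> 0"
  shows "0 < g t \<longleftrightarrow> 0 < g u"
proof -
  have "is_interval (range g)"
    using assms(1) by (simp add: is_interval_connected_1 connected_continuous_image)
  then have "0 < g u" if "0 < g t" for t u
    using that assms(2) mem_is_interval_1_I[of "range g" "g u" "g t" 0]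
    by (metis image_iff linorder_not_less order.strict_implies_order rangeI)
  then show ?thesis by blast
qed

section \<open>The first system\<close>

lemma divergence_P1_Q1: "divergence (P1 a) (Q1 a) u v = 21 * (1 + a) - (42 + 22 * a) * u + 44 * v"
proof -
  have "((\<lambda>s. P1 a s v) has_real_derivative 6 * (1 + a) - 12 * (2 + a) * u + 12 * v) (at u)"
    unfolding P1_def by (auto intro!: derivative_eq_intros)
  moreover have "((\<lambda>s. Q1 a u s) has_real_derivative 15 * (1 + a) - 2 * (9 + 5 * a) * u + 32 * v) (at v)"
    unfolding Q1_def by (auto intro!: derivative_eq_intros)
  ultimately show ?thesis
    unfolding divergence_def by (simp add: DERIV_imp_deriv algebra_simps)
qed

text \<open>\<open>tangent\<close> says that the derivative of \<open>x / sqrt (- y)\<close>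
  vanishes. This condition factors; one factor cannot vanish on the curve below the axis, and the
  other, \<open>U\<close>, also divides the numerator of the derivative of \<open>y / x\<close>
  modulo the curve. Both conditions together leave only \<open>P1 = 0\<close>, then
  \<open>Q1 = 0\<close>.\<close>

lemma system1_lower_half_plane_equilibrium:
  fixes a x y :: real
  assumes F: "F1 a x y = 0" and "y < 0" "0 < a" and tangent: "x * Q1 a x y = 2 * y * P1 a x y"
  shows "P1 a x y = 0 \<and> Q1 a x y = 0"
proof -
  define U where "U = 2 * x * y + a * x\<^sup>2 + y"
  have "x * Q1 a x y - 2 * y * P1 a x y = (3 * (1 + a) * x - 4 * y) * U"
    unfolding U_def P1_def Q1_def by (simp add: algebra_simps eval_nat_numeral)
  then have "(3 * (1 + a) * x - 4 * y) * U = 0" using tangent by simp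
  moreover have "3 * (1 + a) * x - 4 * y \<noteq> 0"
  proof
    assume "3 * (1 + a) * x - 4 * y = 0"
    then have "F1 a x y = 3 * (1 + a) * (a * x\<^sup>2 + y)\<^sup>2 - 4 * y^3"
      unfolding F1_def by (simp add: algebra_simps eval_nat_numeral)
    moreover have "y^3 < 0" using \<open>y < 0\<close> by simp
    moreover have "0 \<le> 3 * (1 + a) * (a * x\<^sup>2 + y)\<^sup>2" using \<open>0 < a\<close> by simp
    ultimately show False using F by linarith
  qed
  ultimately have U: "U = 0" by simp
  have "y\<^sup>2 * (x * Q1 a x y - y * P1 a x y) - 3 / 2 * (1 + a) * (y\<^sup>2 - a\<^sup>2 * x^4) * U
      = (a / 2 * x\<^sup>2 - y / 2 + x * y) * F1 a x y"
    unfolding U_def P1_def Q1_def F1_def by (simp add: field_simps eval_nat_numeral)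
  then have "x * Q1 a x y = y * P1 a x y" using F U \<open>y < 0\<close> by simp
  then have "P1 a x y = 0" "x * Q1 a x y = 0" using tangent \<open>y < 0\<close> by auto
  moreover have "x \<noteq> 0" using U \<open>y < 0\<close> by (auto simp: U_def)
  ultimately show ?thesis by simp
qed

text \<open>On \<open>y = s * x\<^sup>2\<close> the curve becomes \<open>x^4\<close> times a
  quadratic in \<open>x\<close>, and \<open>v\<close> completes its square. The last two equations
  yield the derivatives of \<open>s = y / x\<^sup>2\<close> and
  \<open>v = y / x - 3 / 4 * (1 + a)\<close>; the final one holds only modulo the curve.\<close>

lemma system1_curve:
  fixes a s x :: real
  defines "v \<equiv> s * x - 3 / 4 * (1 + a)" and "w \<equiv> 2 * s * x + s + a"
  assumes F: "F1 a x (s * x\<^sup>2) = 0" and "x \<noteq> 0"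
  shows "4 * s * v\<^sup>2 = - (3 / 4 * (1 + a)) * (4 * s\<^sup>2 + (5 * a - 3) * s + 4 * a\<^sup>2)"
    and "x * Q1 a x (s * x\<^sup>2) - 2 * (s * x\<^sup>2) * P1 a x (s * x\<^sup>2) = x^3 * (- 4 * v * w)"
    and "s\<^sup>2 * (x * Q1 a x (s * x\<^sup>2) - s * x\<^sup>2 * P1 a x (s * x\<^sup>2)) = x\<^sup>2 * (3 / 2 * (1 + a) * (s\<^sup>2 - a\<^sup>2) * w)"
proof -
  define G where "G = 4 * s * v\<^sup>2 + 3 / 4 * (1 + a) * (4 * s\<^sup>2 + (5 * a - 3) * s + 4 * a\<^sup>2)"
  have "F1 a x (s * x\<^sup>2) = x^4 * G"
    unfolding G_def F1_def v_def by (simp add: field_simps eval_nat_numeral)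
  then have G: "G = 0" using F \<open>x \<noteq> 0\<close> by simp
  then show "4 * s * v\<^sup>2 = - (3 / 4 * (1 + a)) * (4 * s\<^sup>2 + (5 * a - 3) * s + 4 * a\<^sup>2)"
    by (simp add: G_def)
  show "x * Q1 a x (s * x\<^sup>2) - 2 * (s * x\<^sup>2) * P1 a x (s * x\<^sup>2) = x^3 * (- 4 * v * w)"
    unfolding P1_def Q1_def v_def w_def by (simp add: field_simps eval_nat_numeral)
  have "s\<^sup>2 * (x * Q1 a x (s * x\<^sup>2) - s * x\<^sup>2 * P1 a x (s * x\<^sup>2)) - x\<^sup>2 * (3 / 2 * (1 + a) * (s\<^sup>2 - a\<^sup>2) * w)
      = x\<^sup>2 * ((a / 2 - s / 2 + s * x) * G)"
    unfolding P1_def Q1_def v_def w_def G_def by (simp add: field_simps eval_nat_numeral)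
  then show "s\<^sup>2 * (x * Q1 a x (s * x\<^sup>2) - s * x\<^sup>2 * P1 a x (s * x\<^sup>2)) = x\<^sup>2 * (3 / 2 * (1 + a) * (s\<^sup>2 - a\<^sup>2) * w)"
    using G by simp
qed

text \<open>
  Up to a positive factor, \<open>oval_weight a s\<close> is the part even in \<open>v\<close> of the divergence of the first system,
  after subtracting the derivatives of \<open>4 ln (w / s)\<close>, of \<open>- 2/5 ln (s x)\<close> and of
  \<open>2/5 v (s - a) / (s + a)\<close>.  The coefficient \<open>2/5\<close> of the second logarithm is forced: as \<open>a\<close> tends to \<open>3/13\<close> the oval shrinks
  to a point with \<open>s = a\<close>, where the weight must have a double zero.
\<close>

definition oval_weight :: "real \<Rightarrow> real \<Rightarrow> real" where
  "oval_weight a s =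
     (s - a)\<^sup>2 * ((s + a) * (s\<^sup>2 + (6 + 5 * a) * s - 2 * a\<^sup>2) - 3 / 4 * (1 + a) * s * (s\<^sup>2 + (6 + 7 * a) * s + 3 * a * (1 + a)))
     - (4 * s\<^sup>2 + (5 * a - 3) * s + 4 * a\<^sup>2) * (s + a) / 4
       * ((s + a) * (s\<^sup>2 + (6 + 7 * a) * s + 3 * a * (1 + a)) - 2 * a * (4 * s + a))"

text \<open>The condition on the quadratic is \<open>v\<^sup>2 \<ge> 0\<close> on the curve. Both
  parts of the weight are nonnegative and could vanish together only at \<open>s = a\<close> with
  the quadratic zero, but there it equals \<open>- a * (3 - 13 * a)\<close>, negative below
  \<open>3 / 13\<close>.\<close>

lemma oval_weight_pos:
  assumes "0 < a" "a < 3 / 13" "0 < s" and q: "4 * s\<^sup>2 + (5 * a - 3) * s + 4 * a\<^sup>2 \<le> 0"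
  shows "0 < oval_weight a s"
proof -
  define q where "q = 4 * s\<^sup>2 + (5 * a - 3) * s + 4 * a\<^sup>2"
  define A where "A = (s + a) * (s\<^sup>2 + (6 + 5 * a) * s - 2 * a\<^sup>2) - 3 / 4 * (1 + a) * s * (s\<^sup>2 + (6 + 7 * a) * s + 3 * a * (1 + a))"
  define C where "C = (s + a) * (s\<^sup>2 + (6 + 7 * a) * s + 3 * a * (1 + a)) - 2 * a * (4 * s + a)"
  have "C = s^3 + (6 + 8 * a) * s\<^sup>2 + (a + 10 * a\<^sup>2) * s + a\<^sup>2 + 3 * a^3"
    unfolding C_def by (simp add: algebra_simps eval_nat_numeral)
  then have C: "0 < C" using assms by (simp add: add_pos_pos)
  have aa: "a\<^sup>2 < 3 / 13 * a" using assms(1,2) unfolding power2_eq_square by simp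
  \<comment> \<open>In powers of \<open>s\<close> the only negative term of \<open>A\<close> is
    \<open>- 2 * a^3\<close>; it is hidden in \<open>- a * q / 2\<close>, which is
    nonnegative.\<close>
  have "A = (1 - 3 * a) / 4 * s^3 + (3 / 2 - 15 / 4 * a - 21 / 4 * a\<^sup>2) * s\<^sup>2
      + a * (9 / 4 + a - 9 / 4 * a\<^sup>2) * s - a * q / 2 + 2 * a * s\<^sup>2"
    unfolding A_def q_def by (simp add: field_simps eval_nat_numeral)
  moreover have "0 < (1 - 3 * a) / 4 * s^3" "0 < (3 / 2 - 15 / 4 * a - 21 / 4 * a\<^sup>2) * s\<^sup>2"
      "0 < a * (9 / 4 + a - 9 / 4 * a\<^sup>2) * s" "0 \<le> - a * q / 2" "0 < 2 * a * s\<^sup>2"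
    using assms aa by (auto simp: q_def mult_nonneg_nonpos intro!: mult_pos_pos)
  ultimately have A: "0 < A" by linarith
  have weight: "oval_weight a s = (s - a)\<^sup>2 * A - q * (s + a) / 4 * C"
    unfolding oval_weight_def A_def C_def q_def by (rule refl)
  show ?thesis
  proof (cases "s = a")
    case True
    then have "q = - (a * (3 - 13 * a))" unfolding q_def by (simp add: algebra_simps power2_eq_square)
    then have "q < 0" using assms by simp
    then have "q * (s + a) / 4 * C < 0" using C assms by (simp add: mult_neg_pos)
    then show ?thesis unfolding weight using True by simp
  next
    case False
    then have "0 < (s - a)\<^sup>2 * A" using A by simp
    moreover have "q * (s + a) / 4 * C \<le> 0" using C assms by (simp add: q_def mult_nonpos_nonneg)
    ultimately show ?thesis unfolding weight by linarith
  qed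
qed

text \<open>
  Multiplying by \<open>1 = (p - 2 v) w s / ((s + a) E)\<close> separates the parts even and odd in \<open>v\<close>;
  the odd part is a rational function of \<open>s\<close> times \<open>s' = - 4 v w\<close>.
\<close>

lemma system1_remainder:
  fixes a s v :: real
  defines "b \<equiv> 3 / 4 * (1 + a)" and "q \<equiv> 4 * s\<^sup>2 + (5 * a - 3) * s + 4 * a\<^sup>2"
    and "E \<equiv> s\<^sup>2 + (6 + 7 * a) * s + 3 * a * (1 + a)"
    and "p \<equiv> s + (3 + 5 * a) / 2" and "w \<equiv> 2 * v + s + (3 + 5 * a) / 2"
  assumes pos: "0 < a" "0 < s" and curve: "4 * s * v\<^sup>2 = - b * q" and "v + b \<noteq> 0"
  shows "4 * a / s * (v - b * (s - a) / s) =
     - (2 / 5) * ((2 * b * (s\<^sup>2 - a\<^sup>2) / s\<^sup>2 * w) / (v + b))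
     + 2 / 5 * ((2 * b * (s\<^sup>2 - a\<^sup>2) / s\<^sup>2 * w) * ((s - a) / (s + a)) + v * (2 * a / (s + a)\<^sup>2 * (- 4 * v * w)))
     + (1 / 5 * ((s - a) / (s * (s + a))) - a * (p / s + 2 * b * (s - a) / s\<^sup>2) * s / ((s + a) * E)) * (- 4 * v * w)
     + 4 / 5 * b * oval_weight a s / (s\<^sup>2 * (s + a)\<^sup>2 * E) * w"
proof -
  have E: "0 < E" unfolding E_def using pos by (simp add: add_pos_pos)
  have nz: "s \<noteq> 0" "s + a \<noteq> 0" "E \<noteq> 0" using pos E by auto
  have v2: "v\<^sup>2 = - b * q / (4 * s)" using curve nz by (simp add: field_simps)
  \<comment> \<open>\<open>p - 2 * v\<close> is the conjugate of \<open>w = p + 2 * v\<close>; on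
    the curve the product depends on \<open>s\<close> alone, and \<open>E\<close> is its cofactor to
    \<open>s + a\<close>.\<close>
  have "s * (w * (p - 2 * v)) = s * p\<^sup>2 - 4 * s * v\<^sup>2"
    unfolding w_def p_def by (simp add: field_simps power2_eq_square)
  also have "\<dots> = (s + a) * E"
    unfolding curve p_def b_def q_def E_def by (simp add: field_simps eval_nat_numeral)
  finally have X: "s * (w * (p - 2 * v)) = (s + a) * E" .
  have "w * (p - 2 * v) * (s / ((s + a) * E)) = s * (w * (p - 2 * v)) / ((s + a) * E)" by simp
  also have "\<dots> = 1" unfolding X using nz by simp
  finally have wD: "w * (p - 2 * v) * (s / ((s + a) * E)) = 1" .
  have "4 * a / s * (v - b * (s - a) / s) = 4 * a / s * (v - b * (s - a) / s) * (w * (p - 2 * v) * (s / ((s + a) * E)))"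
    unfolding wD by simp
  also have "\<dots> = w * (4 * a / ((s + a) * E)) * ((v - b * (s - a) / s) * (p - 2 * v))"
    using nz by simp
  also have "(v - b * (s - a) / s) * (p - 2 * v) = v * (p + 2 * b * (s - a) / s) - 2 * v\<^sup>2 - b * (s - a) / s * p"
    by (simp add: algebra_simps power2_eq_square add_divide_distrib diff_divide_distrib)
  finally have lhs: "4 * a / s * (v - b * (s - a) / s) =
      w * (4 * a / ((s + a) * E)) * (v * (p + 2 * b * (s - a) / s) + b * q / (2 * s) - b * (s - a) / s * p)"
    unfolding v2 by simp
  \<comment> \<open>On the orbit \<open>v + b\<close> is \<open>s * x\<close>. Rationalizing its
    reciprocal with \<open>b - v\<close> makes the logarithmic derivative equal to \<open>w\<close>
    times an expression linear in \<open>v\<close>.\<close>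
  have "s * ((b - v) * (v + b)) = b * (s + a)\<^sup>2"
  proof -
    have "s * ((b - v) * (v + b)) = s * b\<^sup>2 - (4 * s * v\<^sup>2) / 4" by (simp add: algebra_simps power2_eq_square)
    also have "\<dots> = b * (s + a)\<^sup>2" unfolding curve unfolding b_def q_def by (simp add: field_simps power2_eq_square)
    finally show ?thesis .
  qed
  then have vb: "b / (v + b) = s * (b - v) / (s + a)\<^sup>2" using nz \<open>v + b \<noteq> 0\<close> by (simp add: field_simps)
  have "(2 * b * (s\<^sup>2 - a\<^sup>2) / s\<^sup>2 * w) / (v + b) = 2 * (s\<^sup>2 - a\<^sup>2) / s\<^sup>2 * w * (b / (v + b))" by simp
  also have "\<dots> = w * (2 * ((s - a) * (s + a)) / s\<^sup>2 * (s * (b - v) / (s + a)\<^sup>2))"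
    unfolding vb by (simp add: algebra_simps power2_eq_square)
  also have "2 * ((s - a) * (s + a)) / s\<^sup>2 * (s * (b - v) / (s + a)\<^sup>2) = 2 * ((s - a) / (s * (s + a))) * (b - v)"
    using nz by (simp add: power2_eq_square)
  finally have t1: "(2 * b * (s\<^sup>2 - a\<^sup>2) / s\<^sup>2 * w) / (v + b) = w * (2 * ((s - a) / (s * (s + a))) * (b - v))" .
  have t2: "(2 * b * (s\<^sup>2 - a\<^sup>2) / s\<^sup>2 * w) * ((s - a) / (s + a)) + v * (2 * a / (s + a)\<^sup>2 * (- 4 * v * w))
      = w * (2 * b * ((s - a)\<^sup>2 / s\<^sup>2 + a * q / (s * (s + a)\<^sup>2)))"
  proof -
    have "v * (2 * a / (s + a)\<^sup>2 * (- 4 * v * w)) = w * (- 8 * a / (s + a)\<^sup>2 * v\<^sup>2)"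
      by (simp add: power2_eq_square)
    also have "\<dots> = w * (2 * b * (a * q / (s * (s + a)\<^sup>2)))"
      unfolding v2 using nz by (simp add: field_simps)
    finally have "v * (2 * a / (s + a)\<^sup>2 * (- 4 * v * w)) = w * (2 * b * (a * q / (s * (s + a)\<^sup>2)))" .
    moreover have "(2 * b * (s\<^sup>2 - a\<^sup>2) / s\<^sup>2 * w) * ((s - a) / (s + a)) = w * (2 * b * ((s - a)\<^sup>2 / s\<^sup>2))"
      using nz by (simp add: divide_simps) (simp add: algebra_simps power2_eq_square)
    ultimately show ?thesis by (simp add: algebra_simps)
  qed
  have even: "4 * a / ((s + a) * E) * (b * q / (2 * s) - b * (s - a) / s * p) =
      - (4 / 5) * b * ((s - a) / (s * (s + a))) + 4 / 5 * b * ((s - a)\<^sup>2 / s\<^sup>2 + a * q / (s * (s + a)\<^sup>2))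
      + 4 / 5 * b * oval_weight a s / (s\<^sup>2 * (s + a)\<^sup>2 * E)"
  proof -
    \<comment> \<open>The even part with denominators cleared; the polynomial
      \<open>oval_weight\<close> is exactly what is left over here.\<close>
    have key: "5 * a * (q - 2 * (s - a) * p) * s * (s + a) =
        - 2 * (s - a) * s * (s + a) * E + 2 * E * ((s - a)\<^sup>2 * (s + a)\<^sup>2 + a * q * s) + 2 * oval_weight a s"
      unfolding q_def p_def E_def oval_weight_def by (simp add: field_simps eval_nat_numeral)
    define K where "K = 2 * b / (5 * s\<^sup>2 * (s + a)\<^sup>2 * E)"
    have "b * q / (2 * s) - b * (s - a) / s * p = b * (q - 2 * (s - a) * p) / (2 * s)"
      using nz by (simp add: field_simps)
    then have "4 * a / ((s + a) * E) * (b * q / (2 * s) - b * (s - a) / s * p)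
        = K * (5 * a * (q - 2 * (s - a) * p) * s * (s + a))"
      unfolding K_def using nz by (simp add: power2_eq_square)
    also have "\<dots> = K * (- 2 * (s - a) * s * (s + a) * E) + K * (2 * E * ((s - a)\<^sup>2 * (s + a)\<^sup>2))
        + K * (2 * E * (a * q * s)) + K * (2 * oval_weight a s)"
      unfolding key by (simp only: distrib_left)
    also have "K * (- 2 * (s - a) * s * (s + a) * E) = - (4 / 5) * b * ((s - a) / (s * (s + a)))"
      unfolding K_def using nz by (simp add: power2_eq_square) (simp add: algebra_simps minus_divide_left)
    also have "K * (2 * E * ((s - a)\<^sup>2 * (s + a)\<^sup>2)) = 4 / 5 * b * ((s - a)\<^sup>2 / s\<^sup>2)"
      unfolding K_def using nz by simp
    also have "K * (2 * E * (a * q * s)) = 4 / 5 * b * (a * q / (s * (s + a)\<^sup>2))"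
      unfolding K_def using nz by (simp add: power2_eq_square)
    also have "K * (2 * oval_weight a s) = 4 / 5 * b * oval_weight a s / (s\<^sup>2 * (s + a)\<^sup>2 * E)"
      unfolding K_def by simp
    finally show ?thesis by (simp only: distrib_left add.assoc)
  qed
  have ps: "(p / s + 2 * b * (s - a) / s\<^sup>2) * s = p + 2 * b * (s - a) / s"
    using nz by (simp add: distrib_right power2_eq_square)
  \<comment> \<open>Besides its even part, the logarithmic derivative of \<open>v + b\<close>
    contributes the odd term \<open>4 / 5 * h * v\<close>; the summand \<open>1 / 5 * h\<close> in
    the coefficient of \<open>s'\<close> cancels it.\<close>
  have oddI: "4 * a / A * (v * X) = 4 / 5 * h * v + (1 / 5 * h - a * X / A) * (- 4 * v)" for A X h :: real
    by (simp add: algebra_simps)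
  have odd: "4 * a / ((s + a) * E) * (v * (p + 2 * b * (s - a) / s)) =
      4 / 5 * ((s - a) / (s * (s + a))) * v
      + (1 / 5 * ((s - a) / (s * (s + a))) - a * (p / s + 2 * b * (s - a) / s\<^sup>2) * s / ((s + a) * E)) * (- 4 * v)"
    unfolding mult.assoc[of a] ps by (rule oddI)
  have split: "w * c * (V + A - B) = w * (c * (A - B)) + w * (c * V)" for c V A B :: real
    by (simp add: algebra_simps)
  have regroup: "w * (- (4 / 5) * b * h + 4 / 5 * b * Z + K) + w * (4 / 5 * h * v + B * (- 4 * v))
      = - (2 / 5) * (w * (2 * h * (b - v))) + 2 / 5 * (w * (2 * b * Z)) + B * (- 4 * v * w) + K * w" for h Z K B :: real
    by (simp add: algebra_simps)
  show ?thesis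
    unfolding lhs t1 t2 split even odd by (rule regroup)
qed

lemma hyperbolic_cycle_system1:
  assumes a: "0 < a" "a < 3 / 13" and orb: "periodic_orbit_on (P1 a) (Q1 a) (F1 a) x y T"
  shows "hyperbolic_cycle (P1 a) (Q1 a) x y T"
proof -
  note D = periodic_orbit_onD[OF orb]
  have nonequilibrium: "P1 a (x t) (y t) \<noteq> 0 \<or> Q1 a (x t) (y t) \<noteq> 0" for t
    by (rule quadratic_orbit_not_equilibrium[OF orb,
        of 0 "6*(1+a)" 2 "- 6*(2+a)" 12 0 0 0 "15*(1+a)" "3*a*(1+a)" "- 2*(9+5*a)" 16])
       (auto simp: P1_def Q1_def algebra_simps)
  have conts: "continuous_on S x" "continuous_on S y" for S
    by (rule has_real_derivative_imp_continuous_on, rule D)+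
  have y0: "y t \<noteq> 0" for t
    using D(6)[of t] nonequilibrium[of t] a by (auto simp: F1_def P1_def Q1_def)
  have ypos: "0 < y t" for t
  proof (rule ccontr)
    assume "\<not> 0 < y t"
    then have neg: "y u < 0" for u
      using nonvanishing_imp_constant_sign[OF conts(2) y0, of t u] y0[of u] by simp
    \<comment> \<open>The curve crosses \<open>x = 0\<close> below the axis, at
      \<open>y = - 3 / 4 * (1 + a)\<close>, so \<open>y / x\<^sup>2\<close> is singular there;
      \<open>x / z\<close> is a regular substitute.\<close>
    define z where "z u = sqrt (- y u)" for u
    define z' where "z' u = - Q1 a (x u) (y u) / (2 * z u)" for u
    have z: "0 < z u" "(z u)\<^sup>2 = - y u" for u using neg[of u] by (auto simp: z_def)
    have dz: "(z has_real_derivative z' u) (at u)" for u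
      unfolding z_def[abs_def] z'_def using neg[of u]
      by (auto intro!: derivative_eq_intros D simp: divide_simps)
    have "((\<lambda>u. x u / z u) has_real_derivative (P1 a (x u) (y u) * z u - x u * z' u) / (z u * z u)) (at u)" for u
      using z(1)[of u] by (auto intro!: derivative_eq_intros D dz)
    from closed_derivative_zero[OF D(1) this] obtain u where "(P1 a (x u) (y u) * z u - x u * z' u) / (z u * z u) = 0"
      using D(4,5) by (auto simp: z_def)
    then have "P1 a (x u) (y u) * z u = x u * z' u" using z(1)[of u] by simp
    then have "2 * (z u)\<^sup>2 * P1 a (x u) (y u) = - x u * Q1 a (x u) (y u)"
      using z(1)[of u] by (simp add: z'_def field_simps power2_eq_square)
    then have "x u * Q1 a (x u) (y u) = 2 * y u * P1 a (x u) (y u)"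
      unfolding z(2) by simp
    then show False
      using system1_lower_half_plane_equilibrium[OF D(6) neg a(1)] nonequilibrium[of u] by blast
  qed
  have xpos: "0 < x t" for t
  proof (rule ccontr)
    assume "\<not> 0 < x t"
    then have "3 * (1 + a) * x t \<le> 0" using a by (intro mult_nonneg_nonpos) auto
    then have "0 < 2 * y t - 3 * (1 + a) * x t" using ypos[of t] by linarith
    then have "0 < 2 * (y t)\<^sup>2 * (2 * y t - 3 * (1 + a) * x t)" using ypos[of t] by simp
    moreover have "0 \<le> 3 * (1 + a) * (a * (x t)\<^sup>2 + y t)\<^sup>2" using a by simp
    ultimately show False using D(6)[of t] unfolding F1_def by linarith
  qed
  have x0: "x t \<noteq> 0" for t using xpos[of t] by simp
  define b where "b = 3 / 4 * (1 + a)"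
  define s where "s t = y t / (x t)\<^sup>2" for t
  define v where "v t = s t * x t - b" for t
  define w where "w t = 2 * s t * x t + s t + a" for t
  define s' where "s' t = - 4 * v t * w t" for t
  define v' where "v' t = 2 * b * ((s t)\<^sup>2 - a\<^sup>2) / (s t)\<^sup>2 * w t" for t
  have b: "0 < b" using a by (simp add: b_def)
  have y: "y t = s t * (x t)\<^sup>2" for t using x0[of t] by (simp add: s_def)
  have spos: "0 < s t" for t using xpos[of t] ypos[of t] by (simp add: s_def)
  have wpos: "0 < w t" for t using xpos[of t] spos[of t] a by (simp add: w_def add_pos_pos)
  have vb: "0 < v t + b" for t using xpos[of t] spos[of t] by (simp add: v_def)
  have F: "F1 a (x t) (s t * (x t)\<^sup>2) = 0" for t using D(6)[of t] unfolding y .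
  note V = system1_curve[OF F x0, folded y, folded b_def, folded v_def w_def]
  have dv_y: "v t = y t / x t - b" for t using x0[of t] by (simp add: v_def s_def power2_eq_square)
  have ds: "(s has_real_derivative s' t) (at t)" for t
  proof -
    have "(s has_real_derivative (Q1 a (x t) (y t) * (x t)\<^sup>2 - y t * (2 * x t * P1 a (x t) (y t))) / ((x t)\<^sup>2 * (x t)\<^sup>2)) (at t)"
      unfolding s_def[abs_def] using x0[of t] by (auto intro!: derivative_eq_intros D)
    moreover have "Q1 a (x t) (y t) * (x t)\<^sup>2 - y t * (2 * x t * P1 a (x t) (y t))
        = x t * (x t * Q1 a (x t) (y t) - 2 * y t * P1 a (x t) (y t))"
      by (simp add: algebra_simps power2_eq_square)
    then have "Q1 a (x t) (y t) * (x t)\<^sup>2 - y t * (2 * x t * P1 a (x t) (y t)) = s' t * ((x t)\<^sup>2 * (x t)\<^sup>2)"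
      unfolding V(2) s'_def by (simp add: eval_nat_numeral)
    ultimately show ?thesis using x0[of t] by simp
  qed
  have dv: "(v has_real_derivative v' t) (at t)" for t
  proof -
    have "(v has_real_derivative (Q1 a (x t) (y t) * x t - y t * P1 a (x t) (y t)) / (x t * x t)) (at t)"
      unfolding dv_y[abs_def] using x0[of t] by (auto intro!: derivative_eq_intros D)
    moreover have "(Q1 a (x t) (y t) * x t - y t * P1 a (x t) (y t)) / (x t * x t) = v' t"
      using V(3)[of t] spos[of t] x0[of t] by (simp add: v'_def b_def field_simps power2_eq_square)
    ultimately show ?thesis by simp
  qed
  define w' where "w' t = 2 * v' t + s' t" for t
  have wv: "w t = 2 * v t + s t + (3 + 5 * a) / 2" for t
    unfolding w_def v_def b_def by (simp add: field_simps)
  have dw: "(w has_real_derivative w' t) (at t)" for t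
    unfolding wv[abs_def] w'_def by (auto intro!: derivative_eq_intros dv ds)
  have conts': "continuous_on S s" "continuous_on S v" "continuous_on S w" for S
    by (rule has_real_derivative_imp_continuous_on, rule ds dv dw)+
  have closed: "s T = s 0" "v T = v 0" "w T = w 0"
    using D(4,5) by (auto simp: s_def v_def w_def)
  define E where "E s = s\<^sup>2 + (6 + 7 * a) * s + 3 * a * (1 + a)" for s
  have Epos: "0 < E s" if "0 < s" for s unfolding E_def using that a by (simp add: add_pos_pos)
  define B where "B s = 1 / 5 * ((s - a) / (s * (s + a)))
      - a * ((s + (3 + 5 * a) / 2) / s + 2 * b * (s - a) / s\<^sup>2) * s / ((s + a) * E s)" for s
  define W' where "W' t = v' t * ((s t - a) / (s t + a)) + v t * (2 * a / (s t + a)\<^sup>2 * s' t)" for t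
  define k where "k t = 4 / 5 * b * oval_weight a (s t) / ((s t)\<^sup>2 * (s t + a)\<^sup>2 * E (s t)) * w t" for t
  define e where "e t = 4 * (w' t / w t) - 4 * (s' t / s t) - 2 / 5 * (v' t / (v t + b)) + 2 / 5 * W' t + B (s t) * s' t" for t
  have "((\<lambda>t. w' t / w t) has_integral 0) {0..T}" "((\<lambda>t. s' t / s t) has_integral 0) {0..T}"
    using closed_log_derivative_has_integral_0[OF D(1)] dw ds closed wpos spos by blast+
  moreover have "((\<lambda>t. v' t / (v t + b)) has_integral 0) {0..T}"
    by (rule closed_log_derivative_has_integral_0[OF D(1)])
       (use closed vb in \<open>auto intro!: derivative_eq_intros dv\<close>)
  moreover have "(W' has_integral 0) {0..T}"
  proof -
    have "((\<lambda>t. v t * ((s t - a) / (s t + a))) has_real_derivative W' t) (at t)" for t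
      unfolding W'_def using spos[of t] a
      by (auto intro!: derivative_eq_intros dv ds simp: divide_simps) (simp add: algebra_simps power2_eq_square)
    from closed_substitution_has_integral_0[OF _ this, of T UNIV "\<lambda>_. 1"] show ?thesis
      using D(1) closed by simp
  qed
  moreover have "((\<lambda>t. B (s t) * s' t) has_integral 0) {0..T}"
  proof (rule closed_substitution_has_integral_0[where g = s and g' = s' and f = B and S = "{0<..}"])
    have "continuous_on {0<..} E" unfolding E_def[abs_def] by (intro continuous_intros)
    moreover have "E u \<noteq> 0" if "0 < u" for u using Epos[OF that] by simp
    ultimately show "continuous_on {0<..} B"
      unfolding B_def[abs_def] using a by (auto intro!: continuous_intros)
  qed (use D(1) ds closed spos in \<open>auto simp: is_interval_1\<close>)
  ultimately have I: "(e has_integral 0) {0..T}"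
    unfolding e_def[abs_def]
    by (intro has_integral_0_linear)
  have kpos: "0 < k t" for t
  proof -
    have "b * (4 * (s t)\<^sup>2 + (5 * a - 3) * s t + 4 * a\<^sup>2) = - (4 * s t * (v t)\<^sup>2)"
      using V(1)[of t] by simp
    also have "\<dots> \<le> 0" using spos[of t] by simp
    finally have "0 < oval_weight a (s t)"
      using b a spos[of t] by (intro oval_weight_pos) (auto simp: mult_le_0_iff)
    then show ?thesis
      unfolding k_def using b a spos[of t] Epos[OF spos[of t]] wpos[of t] by simp
  qed
  have "continuous_on {0..T} k"
  proof -
    have "E (s t) \<noteq> 0" "s t + a \<noteq> 0" "s t \<noteq> 0" for t using Epos[OF spos[of t]] spos[of t] a by auto
    then show ?thesis
      unfolding k_def[abs_def] oval_weight_def E_def by (auto intro!: continuous_intros conts')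
  qed
  moreover have "divergence (P1 a) (Q1 a) (x t) (y t) = e t + 1 * k t" for t
  proof -
    have nz: "s t \<noteq> 0" "w t \<noteq> 0" using spos[of t] wpos[of t] by auto
    have 1: "w' t / w t = 4 * b * ((s t)\<^sup>2 - a\<^sup>2) / (s t)\<^sup>2 - 4 * v t"
      unfolding w'_def v'_def s'_def using nz by (simp add: field_simps)
    have 2: "s' t / s t = - 4 * v t * (2 * v t + s t + (3 + 5 * a) / 2) / s t"
      unfolding s'_def wv by simp
    have xv: "x t = (v t + b) / s t" using nz by (simp add: v_def)
    have "divergence (P1 a) (Q1 a) (x t) (y t) = 21 * (1 + a) - (42 + 22 * a) * ((v t + b) / s t) + 44 * ((v t + b)\<^sup>2 / s t)"
      unfolding divergence_P1_Q1 y xv using nz by (simp add: power2_eq_square)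
    also have "\<dots> = 4 * (w' t / w t) - 4 * (s' t / s t) + 4 * a / s t * (v t - b * (s t - a) / s t)"
    proof -
      have "(s t)\<^sup>2 * (21 * (1 + a) - (42 + 22 * a) * ((v t + b) / s t) + 44 * ((v t + b)\<^sup>2 / s t)) =
          21 * (1 + a) * (s t)\<^sup>2 - (42 + 22 * a) * (v t + b) * s t + 44 * (v t + b)\<^sup>2 * s t"
        using nz by (simp add: field_simps power2_eq_square)
      \<comment> \<open>The last summand is three times the curve equation, hence zero; it removes
        the surplus in \<open>v\<^sup>2\<close>.\<close>
      also have "\<dots> = 16 * b * ((s t)\<^sup>2 - a\<^sup>2) - 16 * v t * (s t)\<^sup>2 + 16 * v t * (2 * v t + s t + (3 + 5 * a) / 2) * s t
          + 4 * a * (v t * s t - b * (s t - a)) + 3 * (4 * s t * (v t)\<^sup>2 + b * (4 * (s t)\<^sup>2 + (5 * a - 3) * s t + 4 * a\<^sup>2))"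
        unfolding b_def by (simp add: field_simps power2_eq_square)
      also have "\<dots> = 16 * b * ((s t)\<^sup>2 - a\<^sup>2) - 16 * v t * (s t)\<^sup>2 + 16 * v t * (2 * v t + s t + (3 + 5 * a) / 2) * s t
          + 4 * a * (v t * s t - b * (s t - a))"
        using V(1)[of t] by simp
      also have "\<dots> = (s t)\<^sup>2 * (4 * (w' t / w t) - 4 * (s' t / s t) + 4 * a / s t * (v t - b * (s t - a) / s t))"
        unfolding 1 2 using nz by (simp add: field_simps power2_eq_square)
      finally show ?thesis using nz by simp
    qed
    also have "4 * a / s t * (v t - b * (s t - a) / s t) = - (2 / 5) * (v' t / (v t + b)) + 2 / 5 * W' t + B (s t) * s' t + k t"
      using system1_remainder[of a "s t" "v t", folded b_def, folded E_def, folded wv, folded v'_def, folded s'_def, folded W'_def,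
          folded B_def, folded k_def] a spos[of t] vb[of t] V(1)[of t] by simp
    finally show ?thesis unfolding e_def by simp
  qed
  ultimately show ?thesis
    unfolding hyperbolic_cycle_def using D(1) kpos[THEN less_imp_le] kpos[of 0]
    by (intro integral_nonzero_modulo_closed[OF D(1) I, of k 0 _ 1]) auto
qed

section \<open>The second system\<close>

lemma divergence_P2_Q2: "divergence (P2 a) (Q2 a) u v = 7 + 16 * u + (8 + 10 * a) * v"
proof -
  have "((\<lambda>s. P2 a s v) has_real_derivative 5 + 12 * u + 4 * (1 + a) * v) (at u)"
    unfolding P2_def by (auto intro!: derivative_eq_intros)
  moreover have "((\<lambda>s. Q2 a u s) has_real_derivative 2 + 4 * u + 2 * (2 + 3 * a) * v) (at v)"
    unfolding Q2_def by (auto intro!: derivative_eq_intros)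
  ultimately show ?thesis
    unfolding divergence_def by (simp add: DERIV_imp_deriv algebra_simps)
qed

text \<open>Here \<open>tangent\<close> is the vanishing derivative of
  \<open>y / sqrt (- x)\<close>. Modulo the curve it factors. The square of the first factor is, for
  \<open>x < 0\<close>, a square plus a positive term; vanishing of the second forces
  \<open>y = x\<close>, where \<open>P2\<close> and \<open>Q2\<close> share the factor
  \<open>1 + (2 + a) * x\<close>.\<close>

lemma system2_left_half_plane_equilibrium:
  fixes a x y :: real
  assumes F: "F2 a x y = 0" and "x < 0" "a < 0" and tangent: "2 * x * Q2 a x y = y * P2 a x y"
  shows "P2 a x y = 0 \<and> Q2 a x y = 0"
proof -
  have "x * (2 * x * Q2 a x y - y * P2 a x y) - (2 * x\<^sup>2 + x * y + 2 * a * y^3) * (2 * x * y + x + a * y\<^sup>2)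
      = - 2 * y * F2 a x y"
    unfolding F2_def P2_def Q2_def by (simp add: algebra_simps eval_nat_numeral)
  then have "(2 * x\<^sup>2 + x * y + 2 * a * y^3) * (2 * x * y + x + a * y\<^sup>2) = 0"
    using F tangent by simp
  moreover have "2 * x\<^sup>2 + x * y + 2 * a * y^3 \<noteq> 0"
  proof -
    have "(2 * x\<^sup>2 + x * y + 2 * a * y^3)\<^sup>2 - (y\<^sup>2 * (x + 2 * a * y\<^sup>2)\<^sup>2 - 4 * x * (x + a * y\<^sup>2)\<^sup>2) = 4 * x * F2 a x y"
      unfolding F2_def by (simp add: algebra_simps eval_nat_numeral)
    then have "(2 * x\<^sup>2 + x * y + 2 * a * y^3)\<^sup>2 = (y * (x + 2 * a * y\<^sup>2))\<^sup>2 + 4 * (- x) * (x + a * y\<^sup>2)\<^sup>2"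
      using F by (simp add: power_mult_distrib)
    moreover have "x + a * y\<^sup>2 < 0"
      using assms(2,3) by (simp add: add_neg_nonpos mult_nonpos_nonneg)
    then have "0 < 4 * (- x) * (x + a * y\<^sup>2)\<^sup>2"
      using assms(2) by (intro mult_pos_pos) auto
    ultimately have "0 < (2 * x\<^sup>2 + x * y + 2 * a * y^3)\<^sup>2"
      by (metis add_nonneg_pos zero_le_power2)
    then show ?thesis by auto
  qed
  ultimately have U: "2 * x * y + x + a * y\<^sup>2 = 0" by simp
  have "F2 a x y = x\<^sup>2 * (x - y)"
    using U unfolding F2_def by algebra
  then have "y = x" using F assms(2) by simp
  with U have "x * (1 + (2 + a) * x) = 0" by (simp add: algebra_simps power2_eq_square)
  then have "1 + (2 + a) * x = 0" using assms(2) by simp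
  moreover have "P2 a x x = 5 * x * (1 + (2 + a) * x)" "Q2 a x x = 3 * x * (1 + (2 + a) * x)"
    unfolding P2_def Q2_def by (simp_all add: algebra_simps power2_eq_square)
  ultimately show ?thesis using \<open>y = x\<close> by simp
qed

text \<open>On \<open>x = r * y\<^sup>2\<close> the curve becomes \<open>y^4\<close> times a
  quadratic in \<open>y\<close>, whose square \<open>v\<close> completes. \<open>R\<close> is the
  derivative of \<open>r\<close>, so \<open>U / r\<close> is the factor \<open>h\<close>. The third
  and fourth facts identify \<open>r * U\<close> as \<open>m - v\<close> and evaluate its product
  with the conjugate \<open>m + v\<close>; the fifth shows that the logarithmic derivative of
  \<open>U\<close> has no pole at \<open>U = 0\<close>.\<close>

lemma system2_curve:
  fixes a r y :: real
  defines "v \<equiv> 2 * r\<^sup>2 * y + r + 2 * a" and "U \<equiv> - (2 * r * y + r + a)" and "m \<equiv> r + 2 * a - r * (r + a)"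
    and "R \<equiv> r + a - 2 * r * (r + a) * y - 2 * r\<^sup>2 * y\<^sup>2"
  assumes F: "F2 a (r * y\<^sup>2) y = 0" and "y \<noteq> 0"
  shows "v\<^sup>2 = (r + 2 * a)\<^sup>2 - 4 * r * (r + a)\<^sup>2"
    and "r * R = v * U"
    and "m - v = r * U"
    and "r * U * (m + v) = r\<^sup>2 * ((r + a) * (r + a + 2))"
    and "r * (- (2 * R * y + 2 * r * Q2 a (r * y\<^sup>2) y + R)) + R * U = U * (2 * r * y * (1 - a - 2 * r) + 4 * r + 3 * a)"
    and "r^3 * y\<^sup>2 + r * (r + 2 * a) * y + (r + a)\<^sup>2 = 0"
proof -
  define G where "G = r^3 * y\<^sup>2 + r * (r + 2 * a) * y + (r + a)\<^sup>2"
  have "F2 a (r * y\<^sup>2) y = y^4 * G"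
    unfolding G_def F2_def by (simp add: algebra_simps eval_nat_numeral)
  then have G: "G = 0" using F \<open>y \<noteq> 0\<close> by simp
  then show "r^3 * y\<^sup>2 + r * (r + 2 * a) * y + (r + a)\<^sup>2 = 0" by (simp add: G_def)
  have 1: "v\<^sup>2 - ((r + 2 * a)\<^sup>2 - 4 * r * (r + a)\<^sup>2) = 4 * r * G"
    unfolding G_def v_def by (simp add: algebra_simps eval_nat_numeral)
  then show "v\<^sup>2 = (r + 2 * a)\<^sup>2 - 4 * r * (r + a)\<^sup>2" using G by simp
  have "r * R - v * U = 2 * G"
    unfolding G_def v_def R_def U_def by (simp add: algebra_simps eval_nat_numeral)
  then show "r * R = v * U" using G by simp
  show mv: "m - v = r * U"
    unfolding m_def v_def U_def by (simp add: algebra_simps eval_nat_numeral)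
  have "(m - v) * (m + v) - r\<^sup>2 * ((r + a) * (r + a + 2)) = - 4 * r * G"
    unfolding G_def v_def m_def by (simp add: algebra_simps eval_nat_numeral)
  then show "r * U * (m + v) = r\<^sup>2 * ((r + a) * (r + a + 2))" using G mv by simp
  have "r * (- (2 * R * y + 2 * r * Q2 a (r * y\<^sup>2) y + R)) + R * U
      - U * (2 * r * y * (1 - a - 2 * r) + 4 * r + 3 * a) = 2 * G"
    unfolding G_def R_def U_def Q2_def by (simp add: algebra_simps eval_nat_numeral)
  then show "r * (- (2 * R * y + 2 * r * Q2 a (r * y\<^sup>2) y + R)) + R * U = U * (2 * r * y * (1 - a - 2 * r) + 4 * r + 3 * a)"
    using G by simp
qed

text \<open>If \<open>r + 2 * a\<close> were not positive, no term of the quadratic in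
  \<open>y\<close> would be negative and one would be positive. For the second bound,
  \<open>m - v\<close> and \<open>m + v\<close> have a positive product and sum
  \<open>2 * m\<close>, so \<open>m > 0\<close> suffices.\<close>

lemma system2_oval_bounds:
  fixes a r y :: real
  assumes F: "F2 a (r * y\<^sup>2) y = 0" and "a < 0" "0 < r" "y < 0" 
  shows "0 < r + 2 * a" and "2 * r * y + r + a < 0"
proof -
  note C = system2_curve[OF F] 
  show ra: "0 < r + 2 * a"
  proof (rule ccontr)
    assume "\<not> ?thesis"
    then have "0 \<le> r * (r + 2 * a) * y" using assms by (simp add: mult_nonneg_nonpos mult_nonpos_nonpos)
    moreover have "0 < r^3 * y\<^sup>2" using assms by simp
    moreover have "0 \<le> (r + a)\<^sup>2" by simp
    ultimately show False using C(6) assms by linarith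
  qed
  then have "0 < r + a" using assms by simp
  define v where "v = 2 * r\<^sup>2 * y + r + 2 * a"
  \<comment> \<open>Nonnegativity of \<open>v\<^sup>2\<close> confines \<open>r\<close> to
    \<open>4 * r < 1\<close>; then \<open>r\<^sup>2 < 4 * r\<close>, and the same inequality gives
    \<open>m > 0\<close>.\<close>
  have c: "4 * r * (r + a)\<^sup>2 \<le> (r + 2 * a)\<^sup>2"
    using C(1) assms(4) zero_le_power2[of v] unfolding v_def by linarith
  also have "(r + 2 * a)\<^sup>2 < 1 * (r + a)\<^sup>2"
    using ra assms by (simp add: power_strict_mono)
  finally have "4 * r < 1"
    using \<open>0 < r + a\<close> by (simp add: mult_less_cancel_right_pos)
  then have "r\<^sup>2 < 4 * r" using assms unfolding power2_eq_square by (intro mult_strict_right_mono) auto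
  then have "(r * (r + a))\<^sup>2 < 4 * r * (r + a)\<^sup>2"
    using \<open>0 < r + a\<close> unfolding power_mult_distrib by (intro mult_strict_right_mono) auto
  then have "r * (r + a) < r + 2 * a"
    using c ra by (meson order.strict_implies_order order.strict_trans2 power_less_imp_less_base)
  moreover have "0 < r * - (2 * r * y + r + a) * (r + 2 * a - r * (r + a) + v)"
    using C(4) assms \<open>0 < r + a\<close> unfolding v_def by simp
  moreover have "r + 2 * a - r * (r + a) - v = r * - (2 * r * y + r + a)"
    using C(3) assms unfolding v_def by simp
  ultimately have "0 < r * - (2 * r * y + r + a)"
    unfolding zero_less_mult_iff[of "r * - (2 * r * y + r + a)"] by linarith
  then show "2 * r * y + r + a < 0" using assms(3) by (simp add: zero_less_mult_iff)
qed

text \<open>The rational bound \<open>- 1 / 2\<close> keeps \<open>2 + 3 * a\<close> positive, so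
  that \<open>y\<close> would be increasing along an orbit in the open first quadrant.\<close>

lemma hyperbolic_cycle_system2:
  assumes a: "- 1 / 2 < a" "a < 0" and orb: "periodic_orbit_on (P2 a) (Q2 a) (F2 a) x y T"
  shows "hyperbolic_cycle (P2 a) (Q2 a) x y T"
proof -
  note D = periodic_orbit_onD[OF orb]
  have nonequilibrium: "P2 a (x t) (y t) \<noteq> 0 \<or> Q2 a (x t) (y t) \<noteq> 0" for t
    by (rule quadratic_orbit_not_equilibrium[OF orb,
        of 0 5 0 6 "4*(1+a)" a 0 1 2 0 4 "2+3*a"])
       (auto simp: P2_def Q2_def algebra_simps)
  have conts: "continuous_on S x" "continuous_on S y" for S
    by (rule has_real_derivative_imp_continuous_on, rule D)+
  have x0: "x t \<noteq> 0" for t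
    using D(6)[of t] nonequilibrium[of t] a by (auto simp: F2_def P2_def Q2_def)
  have xpos: "0 < x t" for t
  proof (rule ccontr)
    assume "\<not> 0 < x t"
    then have neg: "x u < 0" for u
      using nonvanishing_imp_constant_sign[OF conts(1) x0, of t u] x0[of u] by simp
    \<comment> \<open>In the left half plane the curve passes through \<open>(- 1, 0)\<close>, where
      \<open>x / y\<^sup>2\<close> is singular; \<open>y / z\<close> is regular.\<close>
    define z where "z u = sqrt (- x u)" for u
    define z' where "z' u = - P2 a (x u) (y u) / (2 * z u)" for u
    have z: "0 < z u" "(z u)\<^sup>2 = - x u" for u using neg[of u] by (auto simp: z_def)
    have dz: "(z has_real_derivative z' u) (at u)" for u
      unfolding z_def[abs_def] z'_def using neg[of u]
      by (auto intro!: derivative_eq_intros D simp: divide_simps)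
    have "((\<lambda>u. y u / z u) has_real_derivative (Q2 a (x u) (y u) * z u - y u * z' u) / (z u * z u)) (at u)" for u
      using z(1)[of u] by (auto intro!: derivative_eq_intros D dz)
    from closed_derivative_zero[OF D(1) this] obtain u where "(Q2 a (x u) (y u) * z u - y u * z' u) / (z u * z u) = 0"
      using D(4,5) by (auto simp: z_def)
    then have "Q2 a (x u) (y u) * z u = y u * z' u" using z(1)[of u] by simp
    then have "2 * (z u)\<^sup>2 * Q2 a (x u) (y u) = - y u * P2 a (x u) (y u)"
      using z(1)[of u] by (simp add: z'_def field_simps power2_eq_square)
    then have "2 * x u * Q2 a (x u) (y u) = y u * P2 a (x u) (y u)"
      unfolding z(2) by simp
    then show False
      using system2_left_half_plane_equilibrium[OF D(6) neg a(2)] nonequilibrium[of u] by blast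
  qed
  have y0: "y t \<noteq> 0" for t
  proof
    assume "y t = 0"
    then have "(x t)\<^sup>2 + (x t)^3 = 0" using D(6)[of t] by (simp add: F2_def)
    then show False using xpos[of t] by (smt (verit) zero_less_power)
  qed
  have yneg: "y t < 0" for t
  proof (rule ccontr)
    assume "\<not> y t < 0"
    then have ypos: "0 < y u" for u
      using nonvanishing_imp_constant_sign[OF conts(2) y0, of t u] y0[of t] by simp
    obtain u where "Q2 a (x u) (y u) = 0"
      using closed_derivative_zero[OF D(1,3,5)] by blast
    moreover have "0 < 2 + 3 * a" using a by simp
    then have "0 < Q2 a (x u) (y u)"
      unfolding Q2_def using xpos[of u] ypos[of u] by (simp add: add_pos_pos)
    ultimately show False by simp
  qed
  define r where "r t = x t / (y t)\<^sup>2" for t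
  define v where "v t = 2 * (r t)\<^sup>2 * y t + r t + 2 * a" for t
  define U where "U t = - (2 * r t * y t + r t + a)" for t
  define m where "m s = s + 2 * a - s * (s + a)" for s
  define R where "R t = r t + a - 2 * r t * (r t + a) * y t - 2 * (r t)\<^sup>2 * (y t)\<^sup>2" for t
  define U' where "U' t = - (2 * R t * y t + 2 * r t * Q2 a (x t) (y t) + R t)" for t
  have x: "x t = r t * (y t)\<^sup>2" for t using y0[of t] by (simp add: r_def)
  have rpos: "0 < r t" for t using xpos[of t] y0[of t] by (simp add: r_def)
  have F: "F2 a (r t * (y t)\<^sup>2) (y t) = 0" for t using D(6)[of t] unfolding x .
  note V = system2_curve[OF F y0, folded x, folded R_def, folded v_def U_def m_def, folded U'_def]
  have ra: "0 < r t + 2 * a" and Upos: "0 < U t" for t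
    using system2_oval_bounds[OF F a(2) rpos yneg, of t] by (auto simp: U_def)
  have PQ: "P2 a (x t) (y t) * (y t)\<^sup>2 - x t * (2 * y t * Q2 a (x t) (y t)) = R t * ((y t)\<^sup>2 * (y t)\<^sup>2)" for t
    unfolding R_def P2_def Q2_def x by (simp add: algebra_simps eval_nat_numeral)
  have dr: "(r has_real_derivative R t) (at t)" for t
  proof -
    have "(r has_real_derivative (P2 a (x t) (y t) * (y t)\<^sup>2 - x t * (2 * y t * Q2 a (x t) (y t))) / ((y t)\<^sup>2 * (y t)\<^sup>2)) (at t)"
      unfolding r_def[abs_def] using y0[of t] by (auto intro!: derivative_eq_intros D)
    then show ?thesis using y0[of t] unfolding PQ by simp
  qed
  have dU: "(U has_real_derivative U' t) (at t)" for t
    unfolding U_def[abs_def] U'_def by (auto intro!: derivative_eq_intros D dr simp: algebra_simps)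
  have contr: "continuous_on S r" "continuous_on S U" for S
    by (rule has_real_derivative_imp_continuous_on, rule dr dU)+
  have closed: "r T = r 0" "U T = U 0"
    using D(4,5) by (auto simp: r_def U_def)
  define B where "B s = m s / (s * ((s + a) * (s + a + 2)))" for s
  define e where "e t = 2 * (U' t / U t) + 2 * (Q2 a (x t) (y t) / y t) - 2 * (R t / r t) - B (r t) * R t" for t
  have "((\<lambda>t. U' t / U t) has_integral 0) {0..T}" "((\<lambda>t. R t / r t) has_integral 0) {0..T}"
    using closed_log_derivative_has_integral_0[OF D(1)] dU dr closed Upos rpos by blast+
  moreover have "((\<lambda>t. - Q2 a (x t) (y t) / - y t) has_integral 0) {0..T}"
    by (rule closed_log_derivative_has_integral_0[OF D(1)])
       (use D(5) yneg in \<open>auto intro!: derivative_eq_intros D\<close>)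
  then have "((\<lambda>t. Q2 a (x t) (y t) / y t) has_integral 0) {0..T}" by simp
  moreover have "((\<lambda>t. B (r t) * R t) has_integral 0) {0..T}"
  proof (rule closed_substitution_has_integral_0[where g = r and g' = R and f = B and S = "{- a<..}"])
    have "continuous_on {- a<..} (\<lambda>s. m s / (s * ((s + a) * (s + a + 2))))"
      unfolding m_def using a by (auto intro!: continuous_intros)
    then show "continuous_on {- a<..} B" unfolding B_def[abs_def] .
    show "r t \<in> {- a<..}" for t using ra[of t] a by simp
  qed (use D(1) dr closed in \<open>auto simp: is_interval_1\<close>)
  ultimately have I: "(e has_integral 0) {0..T}"
    unfolding e_def[abs_def]
    by (intro has_integral_0_linear)
  define k where "k t = (v t)\<^sup>2 * U t / ((r t)\<^sup>2 * ((r t + a) * (r t + a + 2)))" for t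
  have Dpos: "0 < (r t + a) * (r t + a + 2)" for t
    using ra[of t] a by (intro mult_pos_pos) auto
  have dv: "(v has_real_derivative 4 * r t * R t * y t + 2 * (r t)\<^sup>2 * Q2 a (x t) (y t) + R t) (at t)" for t
    unfolding v_def[abs_def] by (auto intro!: derivative_eq_intros D dr)
  obtain t0 where t0: "t0 \<in> {0..T}" "v t0 \<noteq> 0"
  proof (rule ccontr)
    assume "\<not> thesis"
    with that have v0: "\<And>t. t \<in> {0..T} \<Longrightarrow> v t = 0" by blast
    have mid: "T/2 \<in> {0<..<T}" using D(1) by simp
    have R0: "R (T/2) = 0"
      using V(2)[of "T/2"] v0[of "T/2"] mid rpos[of "T/2"] by simp
    have "4 * r (T/2) * R (T/2) * y (T/2) + 2 * (r (T/2))\<^sup>2 * Q2 a (x (T/2)) (y (T/2)) + R (T/2) = 0"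
      using derivative_zero_of_zero_on_interval[OF dv v0 mid] by blast
    then have Q0: "Q2 a (x (T/2)) (y (T/2)) = 0" using R0 rpos[of "T/2"] by simp
    then have "P2 a (x (T/2)) (y (T/2)) = 0" using PQ[of "T/2"] R0 y0[of "T/2"] by simp
    then show False using nonequilibrium[of "T/2"] Q0 by blast
  qed
  have "divergence (P2 a) (Q2 a) (x t) (y t) = e t + (- 1) * k t" for t
  proof -
    let ?D = "(r t + a) * (r t + a + 2)"
    have nz: "r t \<noteq> 0" "U t \<noteq> 0" "?D \<noteq> 0" "y t \<noteq> 0"
      using rpos[of t] Upos[of t] Dpos[of t] y0[of t] by auto
    have 1: "U' t / U t = (2 * r t * y t * (1 - a - 2 * r t) + 4 * r t + 3 * a - R t) / r t"
      using V(5)[of t] nz by (simp add: field_simps)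
    have 2: "Q2 a (x t) (y t) / y t = r t * y t + 2 + 4 * r t * (y t)\<^sup>2 + (2 + 3 * a) * y t"
      unfolding Q2_def x using nz by (simp add: field_simps power2_eq_square)
    have Rt: "R t = v t * U t / r t" using V(2)[of t] nz by (simp add: field_simps)
    \<comment> \<open>The leftover \<open>v / r\<close> is multiplied by
      \<open>U * (m + v) / (r * ?D) = 1\<close>: the product with \<open>m\<close> is odd in
      \<open>v\<close> and gives \<open>B (r t) * R t\<close>, the product with \<open>v\<close> is
      even and gives \<open>k\<close>.\<close>
    have "B (r t) * R t + k t = v t * (r t * U t * (m (r t) + v t)) / ((r t)\<^sup>2 * r t * ?D)"
      unfolding B_def k_def Rt using nz by (simp add: divide_simps) (simp add: algebra_simps power2_eq_square)
    also have "\<dots> = v t / r t"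
      unfolding V(4) using nz by simp
    finally have 3: "B (r t) * R t + k t = v t / r t" .
    have "divergence (P2 a) (Q2 a) (x t) (y t) = 2 * (U' t / U t) + 2 * (Q2 a (x t) (y t) / y t) - 2 * (R t / r t) - v t / r t"
      unfolding 1 2 unfolding divergence_P2_Q2 R_def v_def x using nz
      by (simp add: divide_simps) (simp add: algebra_simps power2_eq_square)
    then show ?thesis unfolding e_def 3[symmetric] by simp
  qed
  moreover have "continuous_on {0..T} k"
    unfolding k_def[abs_def] v_def using rpos Dpos by (auto intro!: continuous_intros conts contr) (metis less_irrefl mult_eq_0_iff)+
  moreover have "0 \<le> k t" for t
    unfolding k_def using Dpos[of t] Upos[of t] by simp
  moreover have "k t0 \<noteq> 0"
    unfolding k_def using t0(2) Upos[of t0] rpos[of t0] ra[of t0] a by auto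
  ultimately show ?thesis
    unfolding hyperbolic_cycle_def
    by (intro integral_nonzero_modulo_closed[OF D(1) I _ _ t0(1), of k _ "- 1"]) auto
qed

section \<open>The third system\<close>

lemma divergence_P3_Q3: "divergence (P3 a) (Q3 a) u v = 4 - 10 * a * u - 4 * v"
proof -
  have "((\<lambda>s. P3 a s v) has_real_derivative 4 - 8 * a * u + 12 * v) (at u)"
    unfolding P3_def by (auto intro!: derivative_eq_intros)
  moreover have "((\<lambda>s. Q3 a u s) has_real_derivative - 2 * a * u - 16 * v) (at v)"
    unfolding Q3_def by (auto intro!: derivative_eq_intros)
  ultimately show ?thesis
    unfolding divergence_def by (simp add: DERIV_imp_deriv)
qed

text \<open>The curve is quadratic in \<open>x * y\<close>, and \<open>v\<close> completes the
  square. Both \<open>x'\<close> and \<open>v'\<close> contain the factor \<open>v + 3 * x\<close>,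
  whose product with its conjugate is positive for \<open>0 < a\<close> and
  \<open>0 < x\<close>.\<close>

lemma system3_v:
  fixes a x y :: real
  defines "v \<equiv> x * y + 1/2"
  assumes F: "F3 a x y = 0"
  shows "v\<^sup>2 = x * (x - 1 - a * x\<^sup>2)"
    and "x * P3 a x y = 4 * v * (v + 3 * x)"
    and "x * (P3 a x y * y + Q3 a x y * x) = (v + 3 * x) * (4 * x - 2 - 6 * a * x\<^sup>2)"
    and "(v + 3 * x) * (3 * x - v) = x * (a * x\<^sup>2 + 8 * x + 1)"
proof -
  have 1: "v\<^sup>2 - x * (x - 1 - a * x\<^sup>2) = F3 a x y"
    unfolding v_def F3_def by (simp add: field_simps power2_eq_square power3_eq_cube)
  then show "v\<^sup>2 = x * (x - 1 - a * x\<^sup>2)" using F by simp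
  have "x * P3 a x y - 4 * v * (v + 3 * x) = - 4 * F3 a x y"
    unfolding v_def F3_def P3_def by (simp add: field_simps power2_eq_square power3_eq_cube)
  then show "x * P3 a x y = 4 * v * (v + 3 * x)" using F by simp
  have "x * (P3 a x y * y + Q3 a x y * x) - (v + 3 * x) * (4 * x - 2 - 6 * a * x\<^sup>2) = 4 * F3 a x y"
    unfolding v_def F3_def P3_def Q3_def by (simp add: field_simps power2_eq_square power3_eq_cube)
  then show "x * (P3 a x y * y + Q3 a x y * x) = (v + 3 * x) * (4 * x - 2 - 6 * a * x\<^sup>2)" using F by simp
  have "(v + 3 * x) * (3 * x - v) - x * (a * x\<^sup>2 + 8 * x + 1) = - (v\<^sup>2 - x * (x - 1 - a * x\<^sup>2))"
    by (simp add: algebra_simps power2_eq_square)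
  then show "(v + 3 * x) * (3 * x - v) = x * (a * x\<^sup>2 + 8 * x + 1)" using F 1 by simp
qed

lemma hyperbolic_cycle_system3:
  assumes a: "0 < a" and orb: "periodic_orbit_on (P3 a) (Q3 a) (F3 a) x y T"
  shows "hyperbolic_cycle (P3 a) (Q3 a) x y T"
proof -
  note D = periodic_orbit_onD[OF orb]
  define v where "v t = x t * y t + 1/2" for t
  define v' where "v' t = P3 a (x t) (y t) * y t + Q3 a (x t) (y t) * x t" for t
  have dv: "(v has_real_derivative v' t) (at t)" for t
    unfolding v_def[abs_def] v'_def by (auto intro!: derivative_eq_intros D)
  note V = system3_v[OF D(6), folded v_def v'_def]
  have nonequilibrium: "P3 a (x t) (y t) \<noteq> 0 \<or> Q3 a (x t) (y t) \<noteq> 0" for t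
    by (rule quadratic_orbit_not_equilibrium[OF orb,
        of 2 4 0 "-4*a" 12 0 "8-3*a" "-14*a" 0 0 "-2*a" "-8"])
       (auto simp: P3_def Q3_def algebra_simps)
  have x0: "x t \<noteq> 0" for t
    using D(6)[of t] by (auto simp: F3_def)
  have conts: "continuous_on S x" "continuous_on S y" "continuous_on S v" for S
    by (rule has_real_derivative_imp_continuous_on, rule D dv)+
  have xpos: "0 < x t" for t
  proof (rule ccontr)
    assume "\<not> 0 < x t"
    \<comment> \<open>For \<open>x < 0\<close> the curve forces \<open>v \<noteq> 0\<close>, so
      \<open>x' = 0\<close> makes the common factor \<open>v + 3 * x\<close> vanish, and
      \<open>v' = 0\<close> with it: an equilibrium.\<close>
    obtain t1 where P0: "P3 a (x t1) (y t1) = 0"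
      using closed_derivative_zero[OF D(1,2,4)] by blast
    have "x t1 < 0"
      using nonvanishing_imp_constant_sign[OF conts(1) x0, of t t1] x0[of t1] \<open>\<not> 0 < x t\<close> by simp
    moreover have "0 \<le> a * (x t1)\<^sup>2" using a by simp
    ultimately have "0 < (v t1)\<^sup>2"
      unfolding V(1) by (intro mult_neg_neg) auto
    moreover have "v t1 * (v t1 + 3 * x t1) = 0"
      using V(2)[of t1] P0 by simp
    ultimately have "v t1 + 3 * x t1 = 0" by auto
    then have "v' t1 = 0" using V(3)[of t1] x0 by simp
    then show False using nonequilibrium[of t1] P0 x0 by (simp add: v'_def)
  qed
  define w where "w t = v t + 3 * x t" for t
  have wpos: "0 < w t" for t
  proof -
    \<comment> \<open>\<open>w\<close> and \<open>3 * x - v\<close> have a positive product and the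
      positive sum \<open>6 * x\<close>.\<close>
    have "0 < w t * (3 * x t - v t)"
      unfolding w_def V(4) using xpos[of t] a by (simp add: add_pos_pos)
    then show ?thesis
      using xpos[of t] unfolding w_def zero_less_mult_iff by linarith
  qed
  define w' where "w' t = v' t + 3 * P3 a (x t) (y t)" for t
  have dw: "(w has_real_derivative w' t) (at t)" for t
    unfolding w_def[abs_def] w'_def by (auto intro!: derivative_eq_intros D dv)
  have closed: "v T = v 0" "w T = w 0"
    using D(4,5) by (auto simp: v_def w_def)
  have I1: "((\<lambda>t. w' t / w t) has_integral 0) {0..T}"
    using D(1) dw closed(2) wpos by (rule closed_log_derivative_has_integral_0)
  have I2: "((\<lambda>t. P3 a (x t) (y t) / x t) has_integral 0) {0..T}"
    using D(1,2,4) xpos by (rule closed_log_derivative_has_integral_0)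
  have I: "((\<lambda>t. 3 * (w' t / w t) - 10/3 * (P3 a (x t) (y t) / x t)) has_integral 0) {0..T}"
    using I1 I2 by (intro has_integral_0_linear)
  obtain t0 where t0: "t0 \<in> {0..T}" "v t0 \<noteq> 0"
  proof (rule ccontr)
    assume "\<not> thesis"
    with that have v0: "\<And>t. t \<in> {0..T} \<Longrightarrow> v t = 0" by blast
    have mid: "T/2 \<in> {0<..<T}" using D(1) by simp
    then have "v' (T/2) = 0"
      using derivative_zero_of_zero_on_interval[of v v' T "T/2"] dv v0 by blast
    moreover have "P3 a (x (T/2)) (y (T/2)) = 0"
      using V(2)[of "T/2"] v0[of "T/2"] mid x0[of "T/2"] by simp
    ultimately show False using nonequilibrium[of "T/2"] x0[of "T/2"] by (simp add: v'_def)
  qed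
  \<comment> \<open>The coefficient 3 makes the part free of \<open>v\<close> a multiple of
    \<open>1 - 1 / x - a * x\<close>, which is \<open>(v / x)\<^sup>2\<close>; then
    \<open>- 10/3\<close> cancels the term linear in \<open>v\<close>, and
    \<open>16/3 = 40/3 - 8\<close>.\<close>
  have "divergence (P3 a) (Q3 a) (x t) (y t) =
     (3 * (w' t / w t) - 10/3 * (P3 a (x t) (y t) / x t)) + 16/3 * (v t / x t)\<^sup>2" for t
  proof -
    have X: "x t \<noteq> 0" "w t \<noteq> 0" using xpos[of t] wpos[of t] by auto
    have "P3 a (x t) (y t) = 4 * (v t / x t) * w t" 
      using V(2)[of t] X by (simp add: w_def field_simps)
    moreover have "v' t = w t * (4 * x t - 2 - 6 * a * (x t)\<^sup>2) / x t"
      using V(3)[of t] X by (simp add: w_def field_simps)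
    ultimately have 1: "w' t / w t = (12 * v t + 4 * x t - 2 - 6 * a * (x t)\<^sup>2) / x t"
      and 2: "P3 a (x t) (y t) / x t = 4 * (v t / x t) * (v t / x t + 3)"
      unfolding w'_def using X by (simp_all add: field_simps) (simp add: w_def field_simps)
    have y: "y t = (v t - 1/2) / x t" using X by (simp add: v_def)
    show ?thesis
      unfolding 1 2 unfolding divergence_P3_Q3 y using V(1)[of t] X
      by (simp add: field_simps power2_eq_square) algebra
  qed
  then show ?thesis
    unfolding hyperbolic_cycle_def
    by (intro integral_nonzero_modulo_closed[OF D(1) I _ _ t0(1), of "\<lambda>t. (v t / x t)\<^sup>2" _ "16/3"])
       (use t0 x0 in \<open>auto intro!: continuous_intros conts\<close>)
qed

section \<open>Hyperbolicity\<close>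

theorem theorem6:
  shows "(\<forall>a x y T. 0 < a \<and> a < 3/13 \<and> periodic_orbit_on (P1 a) (Q1 a) (F1 a) x y T
            \<longrightarrow> hyperbolic_cycle (P1 a) (Q1 a) x y T)
       \<and> (\<forall>a x y T. (-71 + 17 * sqrt 17) / 32 < a \<and> a < 0 \<and> periodic_orbit_on (P2 a) (Q2 a) (F2 a) x y T
            \<longrightarrow> hyperbolic_cycle (P2 a) (Q2 a) x y T)
       \<and> (\<forall>a x y T. 0 < a \<and> a < 1/4 \<and> periodic_orbit_on (P3 a) (Q3 a) (F3 a) x y T
            \<longrightarrow> hyperbolic_cycle (P3 a) (Q3 a) x y T)"
proof (intro conjI allI impI; elim conjE)
  fix a T :: real and x y :: "real \<Rightarrow> real"
  show "hyperbolic_cycle (P1 a) (Q1 a) x y T"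
    if "0 < a" "a < 3/13" "periodic_orbit_on (P1 a) (Q1 a) (F1 a) x y T"
    using that by (rule hyperbolic_cycle_system1)
  show "hyperbolic_cycle (P2 a) (Q2 a) x y T"
    if a: "(-71 + 17 * sqrt 17) / 32 < a" "a < 0" and orb: "periodic_orbit_on (P2 a) (Q2 a) (F2 a) x y T"
  proof (rule hyperbolic_cycle_system2[OF _ a(2) orb])
    \<comment> \<open>With this estimate the left end of the range is at least
      \<open>- 3 / 32\<close>.\<close>
    have "4 \<le> sqrt 17" by (rule real_le_rsqrt) simp
    then show "- 1 / 2 < a" using a(1) by simp
  qed
  show "hyperbolic_cycle (P3 a) (Q3 a) x y T"
    if "0 < a" "a < 1/4" "periodic_orbit_on (P3 a) (Q3 a) (F3 a) x y T"
    using that(1,3) by (rule hyperbolic_cycle_system3)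
qed

end
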